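(* For any integer $p \ge 0$ and any real $\nu \in [0,1]$, the restriction of $D^p f_{p+\nu}$ to a line passing through the origin, where $f_{p+\nu}(x) := \|x\|^{p+\nu}$ for $x \in \mathbb{E}$, is $\nu$-Hölder continuous with constant $$C_{p,\nu} := \begin{cases} \prod_{i=1}^p (\nu+i), & \text{if } p \text{ is even},\\ 2^{1-\nu}\prod_{i=1}^p (\nu+i), & \text{if } p \text{ is odd}.\end{cases}$$ That is, $\|D^p f_{p+\nu}(x_2) - D^p f_{p+\nu}(x_1)\| \le C_{p,\nu}\|x_2-x_1\|^\nu$ for all $x_1,x_2 \in \mathbb{E}$ lying on a common line through the origin.
   Context: $\mathbb{E}$ is a finite-dimensional real vector space with dual space $\mathbb{E}^*$; $\langle s, x\rangle$ denotes the value of $s \in \mathbb{E}^*$ at $x \in \mathbb{E}$. A self-adjoint positive definite operator $B : \mathbb{E} \to \mathbb{E}^*$ is fixed, and $\|x\| := \langle Bx, x\rangle^{1/2}$. $D^p f$ denotes the $p$-th derivative of $f$ (with $D^0 f = f$); $D^p f(x)$ is a symmetric $p$-multilinear form on $\mathbb{E}$. The norm of a $p$-multilinear form $L$ is $\|L\| := \max_{\|h_1\|=\dots=\|h_p\|=1} |L[h_1,\dots,h_p]|$ (the absolute value when $p=0$). Empty products equal $1$. *)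

theory Defs
  imports "HOL-Analysis.Analysis"
begin

text \<open>
  The type \<open>'a :: euclidean_space\<close> supplies a finite-dimensional real vector space with its
  standard topology, and \<open>'a \<Rightarrow>\<^sub>L real\<close> is its dual. The type's own inner product and norm
  play no role beyond the topology: all norms below come from the operator \<open>B\<close>.
\<close>

definition self_adjoint_pos_def :: "('a::euclidean_space \<Rightarrow> ('a \<Rightarrow>\<^sub>L real)) \<Rightarrow> bool" where
  "self_adjoint_pos_def B \<longleftrightarrow>
     linear B \<and>
     (\<forall>x y. blinfun_apply (B x) y = blinfun_apply (B y) x) \<and>
     (\<forall>x. x \<noteq> 0 \<longrightarrow> blinfun_apply (B x) x > 0)"

definition op_norm :: "('a::euclidean_space \<Rightarrow> ('a \<Rightarrow>\<^sub>L real)) \<Rightarrow> 'a \<Rightarrow> real" where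
  "op_norm B x = sqrt (blinfun_apply (B x) x)"

text \<open>
  A \<open>p\<close>-linear form is represented by its values on lists of length \<open>p\<close>. For multilinear forms
  on a finite-dimensional space the supremum is a maximum; for \<open>p = 0\<close> the only list is \<open>[]\<close>,
  which gives the absolute value.
\<close>

definition form_norm ::
    "('a::euclidean_space \<Rightarrow> ('a \<Rightarrow>\<^sub>L real)) \<Rightarrow> nat \<Rightarrow> ('a list \<Rightarrow> real) \<Rightarrow> real" where
  "form_norm B p L = (SUP hs \<in> {hs. length hs = p \<and> (\<forall>h\<in>set hs. op_norm B h = 1)}. \<bar>L hs\<bar>)"

text \<open>
  Iterated Frechet derivative, evaluated at the directions in the list. It is meaningful only
  under \<open>times_differentiable_at\<close> below. Differentiating the evaluations
  \<open>y \<mapsto> D\<^sup>k f(y)[hs]\<close> for all \<open>hs\<close> is the same as differentiating the form-valued map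
  \<open>y \<mapsto> D\<^sup>k f(y)\<close>, as the space of \<open>k\<close>-linear forms is finite-dimensional.
\<close>

primrec iter_deriv :: "('a::euclidean_space \<Rightarrow> real) \<Rightarrow> 'a list \<Rightarrow> 'a \<Rightarrow> real" where
  "iter_deriv f [] = f"
| "iter_deriv f (h # hs) = (\<lambda>x. frechet_derivative (iter_deriv f hs) (at x) h)"

primrec times_differentiable_at :: "nat \<Rightarrow> ('a::euclidean_space \<Rightarrow> real) \<Rightarrow> 'a \<Rightarrow> bool" where
  "times_differentiable_at 0 f x \<longleftrightarrow> True"
| "times_differentiable_at (Suc k) f x \<longleftrightarrow>
     (\<forall>\<^sub>F y in nhds x. times_differentiable_at k f y) \<and>
     (\<forall>hs. length hs = k \<longrightarrow> iter_deriv f hs differentiable (at x))"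

text \<open>
  The form \<open>D\<^sup>p f(x)\<close>, with the convention that it is the zero form where \<open>f\<close> is not \<open>p\<close> times
  differentiable. For \<open>f = \<parallel>\<cdot>\<parallel>\<^sup>p\<^sup>+\<^sup>\<nu>\<close> this concerns only \<open>x = 0\<close> with \<open>\<nu> = 0\<close> and \<open>p\<close> odd
  (as for \<open>\<parallel>\<cdot>\<parallel>\<close> itself).
\<close>

definition D :: "nat \<Rightarrow> ('a::euclidean_space \<Rightarrow> real) \<Rightarrow> 'a \<Rightarrow> 'a list \<Rightarrow> real" where
  "D p f x = (\<lambda>hs. if times_differentiable_at p f x then iter_deriv f hs x else 0)"

text \<open>Real powers of nonnegative numbers with \<open>0\<^sup>0 = 1\<close>, whereas \<open>0 powr 0 = 0\<close>.\<close>

definition rpow :: "real \<Rightarrow> real \<Rightarrow> real" where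
  "rpow t a = (if a = 0 then 1 else t powr a)"

definition norm_power :: "('a::euclidean_space \<Rightarrow> ('a \<Rightarrow>\<^sub>L real)) \<Rightarrow> real \<Rightarrow> 'a \<Rightarrow> real" where
  "norm_power B q x = rpow (op_norm B x) q"

definition C_const :: "nat \<Rightarrow> real \<Rightarrow> real" where
  "C_const p \<nu> =
     (if even p then (\<Prod>i=1..p. (\<nu> + real i))
      else 2 powr (1 - \<nu>) * (\<Prod>i=1..p. (\<nu> + real i)))"

end

theory Submission imports Defs
begin

text \<open>
  Write \<open>q = p + \<nu>\<close> and \<open>L(x)[h\<^sub>1,\<dots>,h\<^sub>k]\<close> for the \<open>k\<close>-th derivative of \<open>\<parallel>x\<parallel>\<^sup>q\<close> at \<open>x \<noteq> 0\<close>.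
  As a function of \<open>x\<close> it is homogeneous of degree \<open>q - k\<close> and has the parity of \<open>k\<close>. Hence on a
  line \<open>x = a u\<close> the \<open>p\<close>-th derivative equals \<open>\<bar>a\<bar>\<^sup>\<nu> sgn(a)\<^sup>p L(u)\<close>, and the theorem splits into
  a scalar estimate, the \<open>\<nu>\<close>-Hoelder constant of \<open>a \<mapsto> \<bar>a\<bar>\<^sup>\<nu> sgn(a)\<^sup>p\<close> (\<open>signed_powr_hoelder\<close>: 1 suffices
  for even \<open>p\<close>, and \<open>2\<^sup>1\<^sup>-\<^sup>\<nu>\<close> for odd \<open>p\<close>, where \<open>a\<close> and \<open>b\<close> may have opposite signs), and the sharp
  bound \<open>\<bar>L(u)[h\<^sub>1,\<dots>,h\<^sub>k]\<bar> \<le> q (q - 1) \<cdots> (q - k + 1)\<close> for unit vectors and \<open>k \<le> q\<close>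
  (\<open>abs_dpow_le\<close>). Equality holds in the latter for \<open>h\<^sub>1 = \<dots> = h\<^sub>k = u\<close>.

  The sharp bound is proved directly for distinct directions \<open>h\<^sub>i\<close>, without comparing a symmetric form
  with its diagonal. Split every direction as \<open>h = \<tau> e + w\<close> with \<open>w\<close> orthogonal to the unit vector
  \<open>e\<close>. Expanded in the \<open>\<tau>\<^sub>i\<close> and the products \<open>\<langle>w\<^sub>i, w\<^sub>j\<rangle>\<close>, the form \<open>L(e)\<close> has only nonnegative
  coefficients (\<open>dpow_split\<close>). So \<open>\<bar>L(e)\<bar>\<close> can only grow when \<open>\<tau>\<^sub>i\<close> is replaced by \<open>\<bar>\<tau>\<^sub>i\<bar>\<close> and
  \<open>\<langle>w\<^sub>i, w\<^sub>j\<rangle>\<close> by \<open>\<parallel>w\<^sub>i\<parallel> \<parallel>w\<^sub>j\<parallel>\<close>, that is, when all directions are moved into one quadrant of a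
  plane (\<open>abs_dpow_le_plane\<close>). In the plane, let the base point \<open>e\<close> turn towards the directions. The
  derivative of \<open>L(e)[h\<^sub>1,\<dots>,h\<^sub>k]\<close> along this motion is the \<open>(k+1)\<close>-st derivative with one more
  direction in the same quadrant, and is therefore nonnegative (\<open>plane_dpow_mono\<close>). The motion goes on
  until \<open>e\<close> meets the first of the directions; there Euler's relation (\<open>dpow_euler\<close>) splits off the
  factor \<open>q - k + 1\<close> and leaves \<open>k - 1\<close> directions, so that induction applies (\<open>plane_dpow_le\<close>).

  The origin needs separate care. If \<open>k < q\<close>, the bound shows that the \<open>k\<close>-th derivative tends to 0
  there. If \<open>\<nu> = 0\<close> and \<open>p\<close> is even, the function is a polynomial of degree \<open>p\<close>, whose \<open>p\<close>-th
  derivative is constant.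
\<close>

section \<open>Removing one entry from a list\<close>

fun omits :: "'a list \<Rightarrow> ('a \<times> 'a list) list" where
  "omits [] = []"
| "omits (x # xs) = (x, xs) # map (\<lambda>p. (fst p, x # snd p)) (omits xs)"

lemma length_omits: "p \<in> set (omits xs) \<Longrightarrow> length xs = Suc (length (snd p))"
  by (induction xs arbitrary: p) auto

lemma set_omits: "p \<in> set (omits xs) \<Longrightarrow> set xs = insert (fst p) (set (snd p))"
  by (induction xs arbitrary: p) fastforce+

lemma omits_map: "omits (map g xs) = map (\<lambda>p. (g (fst p), map g (snd p))) (omits xs)"
  by (induction xs) auto

lemma sum_omits_snoc:
  fixes G :: "'a \<Rightarrow> 'a list \<Rightarrow> real"
  shows "(\<Sum>p\<leftarrow>omits (xs @ [z]). G (fst p) (snd p))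
       = G z xs + (\<Sum>p\<leftarrow>omits xs. G (fst p) (snd p @ [z]))"
proof (induction xs arbitrary: G)
  case (Cons x xs)
  from Cons[of "\<lambda>y ys. G y (x # ys)"] show ?case by (simp add: o_def)
qed simp

text \<open>
  Removing two entries leaves the same list in whichever order they are removed, so summing over
  ordered pairs of removed entries is symmetric in the two entries.
\<close>

lemma sum_omits_swap:
  fixes G :: "'a \<Rightarrow> 'a \<Rightarrow> 'a list \<Rightarrow> real"
  shows "(\<Sum>a\<leftarrow>omits xs. \<Sum>b\<leftarrow>omits (snd a). G (fst a) (fst b) (snd b))
       = (\<Sum>a\<leftarrow>omits xs. \<Sum>b\<leftarrow>omits (snd a). G (fst b) (fst a) (snd b))"
proof (induction xs arbitrary: G)
  case (Cons x xs)
  from Cons[of "\<lambda>y z ys. G y z (x # ys)"] show ?case by (simp add: o_def sum_list_addf)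
qed simp

lemma sum_omits_cong:
  assumes "\<And>y ys. (y, ys) \<in> set (omits xs) \<Longrightarrow> G y ys = (H y ys :: real)"
  shows "(\<Sum>p\<leftarrow>omits xs. G (fst p) (snd p)) = (\<Sum>p\<leftarrow>omits xs. H (fst p) (snd p))"
  using assms by (intro arg_cong[of _ _ sum_list] map_cong) auto

section \<open>The derivatives of a power of the norm\<close>

text \<open>
  The \<open>k\<close>-th derivative of \<open>\<parallel>x\<parallel>\<^sup>q\<close> in closed form. Differentiating once in direction \<open>h\<close> gives
  \<open>q \<langle>x, h\<rangle> \<parallel>x\<parallel>\<^sup>q\<^sup>-\<^sup>2\<close>; differentiating this product in the remaining directions, the linear factor
  takes at most one of them, which explains the sum over \<open>omits\<close>. The exponent may become negative in the
  recursion, so \<open>q\<close> is an arbitrary real number.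
\<close>

function dpow :: "('a \<Rightarrow> 'a \<Rightarrow> real) \<Rightarrow> real \<Rightarrow> 'a list \<Rightarrow> 'a \<Rightarrow> real" where
  "dpow ip q [] x = rpow (sqrt (ip x x)) q"
| "dpow ip q (h # hs) x = q * (ip x h * dpow ip (q - 2) hs x
      + (\<Sum>p\<leftarrow>omits hs. ip (fst p) h * dpow ip (q - 2) (snd p) x))"
  by pat_completeness auto
termination
  by (relation "Wellfounded.measure (\<lambda>(ip, q, hs, x). length hs)") (auto dest: length_omits)

lemma has_derivative_sum_list:
  fixes f :: "'b \<Rightarrow> 'a::real_normed_vector \<Rightarrow> real"
  assumes "\<And>p. p \<in> set xs \<Longrightarrow> (f p has_derivative f' p) F"
  shows "((\<lambda>y. \<Sum>p\<leftarrow>xs. f p y) has_derivative (\<lambda>k. \<Sum>p\<leftarrow>xs. f' p k)) F"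
  using assms by (induction xs) (auto intro!: has_derivative_add)

text \<open>
  Away from the origin every power of the norm is smooth; at the origin the powers that are
  polynomials are.
\<close>

definition smooth_at :: "real \<Rightarrow> 'a::zero \<Rightarrow> bool" where
  "smooth_at q x \<longleftrightarrow> x \<noteq> 0 \<or> (\<exists>m::nat. q = 2 * real m)"

locale inner_form = bounded_bilinear ip
  for ip :: "'a::real_normed_vector \<Rightarrow> 'a \<Rightarrow> real" +
  assumes sym: "ip x y = ip y x" and pos: "x \<noteq> 0 \<Longrightarrow> ip x x > 0"
begin

text \<open>
  Symmetry of the form, as far as it is needed: a direction may be moved from one end of the list to
  the other. The induction expands both sides twice and compares them by \<open>sum_omits_swap\<close>.
\<close>

lemma dpow_snoc: "dpow ip q (hs @ [k]) x = dpow ip q (k # hs) x"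
proof (induction "length hs" arbitrary: hs q rule: less_induct)
  case less
  show ?case
  proof (cases hs)
    case (Cons h hs')
    have IH: "dpow ip r (ys @ [k]) x = dpow ip r (k # ys) x" if "length ys < length hs" for r ys
      using less that by blast
    have 1: "(\<Sum>p\<leftarrow>omits hs'. ip (fst p) h * dpow ip (q - 2) (snd p @ [k]) x)
           = (\<Sum>p\<leftarrow>omits hs'. ip (fst p) h * dpow ip (q - 2) (k # snd p) x)"
      by (intro sum_omits_cong) (auto simp: IH Cons dest!: length_omits simp del: dpow.simps)
    have expand: "(\<Sum>p\<leftarrow>omits hs'. ip (fst p) u * dpow ip (q - 2) (v # snd p) x)
        = (q - 2) * (ip x v * (\<Sum>p\<leftarrow>omits hs'. ip (fst p) u * dpow ip (q - 4) (snd p) x)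
          + (\<Sum>a\<leftarrow>omits hs'. \<Sum>b\<leftarrow>omits (snd a).
                ip (fst a) u * (ip (fst b) v * dpow ip (q - 4) (snd b) x)))" for u v
    proof -
      have "ip y u * dpow ip (q - 2) (v # ys) x
          = (q - 2) * (ip x v * (ip y u * dpow ip (q - 4) ys x))
          + (q - 2) * (\<Sum>b\<leftarrow>omits ys. ip y u * (ip (fst b) v * dpow ip (q - 4) (snd b) x))" for y ys
        by (simp add: sum_list_const_mult algebra_simps)
      then show ?thesis
        by (simp only: sum_list_addf sum_list_const_mult distrib_left)
    qed
    have "dpow ip q (hs @ [k]) x = q * (ip x h * dpow ip (q - 2) (k # hs') x
        + (ip k h * dpow ip (q - 2) hs' x
        + (\<Sum>p\<leftarrow>omits hs'. ip (fst p) h * dpow ip (q - 2) (k # snd p) x)))"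
      unfolding 1[symmetric] sum_omits_snoc[symmetric, where G = "\<lambda>y ys. ip y h * dpow ip (q - 2) ys x"]
      by (simp add: Cons IH del: dpow.simps(2)) (simp add: IH Cons)
    also have "\<dots> = q * (ip x k * dpow ip (q - 2) (h # hs') x
        + (ip h k * dpow ip (q - 2) hs' x
        + (\<Sum>p\<leftarrow>omits hs'. ip (fst p) k * dpow ip (q - 2) (h # snd p) x)))"
      unfolding expand sum_omits_swap[where G = "\<lambda>y z zs. ip y k * (ip z h * dpow ip (q - 4) zs x)"]
      by (simp add: sym algebra_simps)
    also have "\<dots> = dpow ip q (k # hs) x"
      by (simp add: Cons o_def)
    finally show ?thesis .
  qed simp
qed

text \<open>
  Euler's relation for functions homogeneous of degree \<open>q - k\<close>. With \<open>x\<close> as the last direction it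
  follows by an induction in which the recursion acts on the other directions only; symmetry moves
  \<open>x\<close> to the front.
\<close>

lemma dpow_euler: "dpow ip q (x # hs) x = (q - length hs) * dpow ip q hs x" if "x \<noteq> 0"
proof -
  have base: "ip x x * rpow (sqrt (ip x x)) (q - 2) = rpow (sqrt (ip x x)) q" for q
  proof -
    have t: "sqrt (ip x x) > 0" "ip x x = sqrt (ip x x) powr 2"
      using pos[OF that] by (auto simp: powr_numeral)
    have "ip x x * rpow (sqrt (ip x x)) (q - 2) = sqrt (ip x x) powr 2 * sqrt (ip x x) powr (q - 2)"
      using t by (auto simp: rpow_def)
    also have "\<dots> = sqrt (ip x x) powr q"
      by (simp only: powr_add[symmetric]) simp
    finally show ?thesis using t(1) by (auto simp: rpow_def)
  qed
  have "dpow ip q (hs @ [x]) x = (q - length hs) * dpow ip q hs x"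
  proof (induction "length hs" arbitrary: hs q rule: less_induct)
    case less
    show ?case
    proof (cases hs)
      case (Cons h hs')
      have IH: "dpow ip r (ys @ [x]) x = (r - length ys) * dpow ip r ys x"
        if "length ys < length hs" for r ys
        using less that by blast
      have "(\<Sum>p\<leftarrow>omits hs'. ip (fst p) h * dpow ip (q - 2) (snd p @ [x]) x)
          = (\<Sum>p\<leftarrow>omits hs'. (q - 1 - length hs') * (ip (fst p) h * dpow ip (q - 2) (snd p) x))"
        by (intro sum_omits_cong) (auto simp: IH Cons dest!: length_omits simp del: dpow.simps)
      then have 1: "(\<Sum>p\<leftarrow>omits (hs' @ [x]). ip (fst p) h * dpow ip (q - 2) (snd p) x)
          = ip x h * dpow ip (q - 2) hs' x
           + (q - 1 - length hs') * (\<Sum>p\<leftarrow>omits hs'. ip (fst p) h * dpow ip (q - 2) (snd p) x)"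
        by (simp add: sum_omits_snoc[where G = "\<lambda>y ys. ip y h * dpow ip (q - 2) ys x"] sum_list_const_mult)
      show ?thesis
        unfolding Cons append_Cons dpow.simps 1 using IH[of hs' "q - 2"]
        by (simp only: Cons length_Cons lessI of_nat_Suc) (simp add: algebra_simps)
    qed (simp add: base)
  qed
  then show ?thesis by (simp only: dpow_snoc)
qed

text \<open>
  With \<open>\<tau>\<^sub>h = \<langle>e, h\<rangle>\<close>, the bracket is the inner product of the parts of the directions orthogonal to
  \<open>e\<close>. Euler's relation absorbs the other terms of the recursion. The gain is in the signs: for \<open>k\<close>
  directions in all and \<open>k \<le> q + 1\<close> both coefficients are nonnegative, and the smaller
  forms satisfy the same condition, since two directions are lost when \<open>q\<close> drops by 2. The
  defining recursion, where \<open>q\<close> drops by 2 as one direction is lost, has no such property.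
\<close>

lemma dpow_split:
  assumes e: "ip e e = 1"
  shows "dpow ip q (h # hs) e = (q - length hs) * ip e h * dpow ip q hs e
    + q * (\<Sum>p\<leftarrow>omits hs. (ip (fst p) h - ip e (fst p) * ip e h) * dpow ip (q - 2) (snd p) e)"
proof -
  have "e \<noteq> 0"
  proof
    assume "e = 0"
    then have "ip e e = 0" by (simp only: zero_left)
    then show False by (simp only: e)
  qed
  have E: "(q - length hs) * dpow ip q hs e = q * (dpow ip (q - 2) hs e
      + (\<Sum>p\<leftarrow>omits hs. ip e (fst p) * dpow ip (q - 2) (snd p) e))"
    unfolding dpow_euler[OF \<open>e \<noteq> 0\<close>, symmetric] by (simp add: e sym)
  have "(q - length hs) * ip e h * dpow ip q hs e = q * (ip e h * dpow ip (q - 2) hs e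
      + (\<Sum>p\<leftarrow>omits hs. ip e h * (ip e (fst p) * dpow ip (q - 2) (snd p) e)))"
    unfolding sum_list_const_mult distrib_left[symmetric] mult.left_commute[of q "ip e h"] E[symmetric]
    by simp
  moreover have "(\<Sum>p\<leftarrow>omits hs. ip (fst p) h * dpow ip (q - 2) (snd p) e)
      = (\<Sum>p\<leftarrow>omits hs. ip e h * (ip e (fst p) * dpow ip (q - 2) (snd p) e))
      + (\<Sum>p\<leftarrow>omits hs. (ip (fst p) h - ip e (fst p) * ip e h) * dpow ip (q - 2) (snd p) e)"
    unfolding sum_list_addf[symmetric]
    by (intro arg_cong[of _ _ sum_list] map_cong refl) (simp add: algebra_simps)
  ultimately show ?thesis by (simp add: distrib_left)
qed

lemma nonneg: "ip x x \<ge> 0"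
  using pos[of x] zero_left[of x] by (cases "x = 0") (simp_all add: less_imp_le)

lemma dpow_Nil_powr: "x \<noteq> 0 \<Longrightarrow> dpow ip q [] x = ip x x powr (q / 2)"
  using pos[of x] by (simp add: rpow_def powr_half_sqrt[symmetric] powr_powr)

lemma dpow_Nil_even: "dpow ip (2 * real m) [] x = ip x x ^ m"
proof (cases "x = 0")
  case True
  then show ?thesis using zero_left[of x] by (simp add: rpow_def)
next
  case False
  then show ?thesis using pos[of x] by (simp add: dpow_Nil_powr powr_realpow del: dpow.simps)
qed

lemma quad_has_derivative: "((\<lambda>y. ip y y) has_derivative (\<lambda>k. ip x k + ip k x)) (at x)"
  by (rule FDERIV[OF has_derivative_ident has_derivative_ident])

lemma dpow_Nil_has_derivative:
  assumes "smooth_at q x"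
  shows "(dpow ip q [] has_derivative (\<lambda>k. dpow ip q [k] x)) (at x)"
proof (cases "x = 0")
  case False
  have "((\<lambda>y. ip y y powr (q / 2)) has_derivative (\<lambda>k. dpow ip q [k] x)) (at x)"
  proof (rule has_derivative_eq_rhs)
    show "((\<lambda>y. ip y y powr (q / 2)) has_derivative
        (\<lambda>k. ip x x powr (q / 2) * ((ip x k + ip k x) * (q / 2) / ip x x))) (at x)"
      using pos[OF False] by (auto intro!: derivative_eq_intros has_derivative_eq_rhs[OF quad_has_derivative])
    show "(\<lambda>k. ip x x powr (q / 2) * ((ip x k + ip k x) * (q / 2) / ip x x))
        = (\<lambda>k. dpow ip q [k] x)"
      using pos[OF False] dpow_Nil_powr[OF False, of "q - 2"]
      by (simp add: fun_eq_iff sym powr_diff diff_divide_distrib)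
  qed
  then show ?thesis
    by (rule has_derivative_transform_within_open[where s = "- {0}"])
      (use False in \<open>auto simp: dpow_Nil_powr simp del: dpow.simps\<close>)
next
  case True
  then obtain m :: nat where q: "q = 2 * real m" using assms by (auto simp: smooth_at_def)
  have "((\<lambda>y. ip y y ^ m) has_derivative (\<lambda>k. dpow ip q [k] x)) (at x)"
  proof (rule has_derivative_eq_rhs)
    show "((\<lambda>y. ip y y ^ m) has_derivative
        (\<lambda>k. real m * (ip x k + ip k x) * ip x x ^ (m - 1))) (at x)"
      by (rule has_derivative_eq_rhs[OF has_derivative_power[OF quad_has_derivative]])
        (simp add: fun_eq_iff mult_ac)
    show "(\<lambda>k. real m * (ip x k + ip k x) * ip x x ^ (m - 1)) = (\<lambda>k. dpow ip q [k] x)"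
      by (simp add: True zero_left zero_right)
  qed
  then show ?thesis using dpow_Nil_even[of m] unfolding q by presburger
qed

text \<open>
  Appending the new direction at the end, instead of putting it in front, matches the recursion term by
  term: the product rule turns \<open>\<langle>x, h\<rangle>\<close> into the term of \<open>omits\<close> in which the new direction is
  removed.
\<close>

lemma dpow_has_derivative:
  assumes "smooth_at q x"
  shows "(dpow ip q hs has_derivative (\<lambda>k. dpow ip q (k # hs) x)) (at x)"
  using assms
proof (induction "length hs" arbitrary: hs q rule: less_induct)
  case less
  show ?case
  proof (cases hs)
    case Nil
    then show ?thesis using dpow_Nil_has_derivative less.prems by simp
  next
    case (Cons h hs')
    \<comment> \<open>The factor \<open>q\<close> stops the recursion of an even power before its exponent becomes negative,
      where smoothness at the origin would be lost.\<close>
    show ?thesis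
    proof (cases "q = 0")
      case True
      have "dpow ip 0 hs = (\<lambda>y. 0)" by (simp add: Cons fun_eq_iff)
      then show ?thesis using True by simp
    next
      case False
      have "smooth_at (q - 2) x"
      proof (cases "x = 0")
        case True
        then obtain m where "q = 2 * real m" using less.prems by (auto simp: smooth_at_def)
        with \<open>q \<noteq> 0\<close> have "q - 2 = 2 * real (m - 1)" by (cases m) auto
        then show ?thesis by (auto simp: smooth_at_def)
      qed (auto simp: smooth_at_def)
      then have IH: "(dpow ip (q - 2) ys has_derivative (\<lambda>k. dpow ip (q - 2) (ys @ [k]) x)) (at x)"
        if "length ys < length hs" for ys
        using less.hyps that unfolding dpow_snoc by blast
      have lin: "((\<lambda>y. ip y h) has_derivative (\<lambda>k. ip k h)) (at x)"
        by (intro bounded_linear_imp_has_derivative bounded_linear_left)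
      have "((\<lambda>y. q * (ip y h * dpow ip (q - 2) hs' y
            + (\<Sum>p\<leftarrow>omits hs'. ip (fst p) h * dpow ip (q - 2) (snd p) y)))
          has_derivative (\<lambda>k. q * ((ip x h * dpow ip (q - 2) (hs' @ [k]) x + ip k h * dpow ip (q - 2) hs' x)
            + (\<Sum>p\<leftarrow>omits hs'. ip (fst p) h * dpow ip (q - 2) (snd p @ [k]) x)))) (at x)"
        by (intro has_derivative_mult_right has_derivative_add has_derivative_mult lin IH
            has_derivative_sum_list)
          (auto simp: Cons dest: length_omits)
      moreover have "q * ((ip x h * dpow ip (q - 2) (hs' @ [k]) x + ip k h * dpow ip (q - 2) hs' x)
            + (\<Sum>p\<leftarrow>omits hs'. ip (fst p) h * dpow ip (q - 2) (snd p @ [k]) x)) = dpow ip q (k # hs) x" for k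
        unfolding dpow_snoc[symmetric, of q k hs]
        unfolding Cons append_Cons dpow.simps(2)
          sum_omits_snoc[where G = "\<lambda>y ys. ip y h * dpow ip (q - 2) ys x"]
        by (simp only: add.assoc)
      moreover have "dpow ip q hs = (\<lambda>y. q * (ip y h * dpow ip (q - 2) hs' y
            + (\<Sum>p\<leftarrow>omits hs'. ip (fst p) h * dpow ip (q - 2) (snd p) y)))"
        by (simp add: Cons fun_eq_iff)
      ultimately show ?thesis by simp
    qed
  qed
qed

lemma dpow_scaleR:
  assumes "c \<noteq> 0" "x \<noteq> 0"
  shows "dpow ip q hs (c *\<^sub>R x) = \<bar>c\<bar> powr (q - length hs) * sgn c ^ length hs * dpow ip q hs x"
proof (induction "length hs" arbitrary: hs q rule: less_induct)
  case less
  show ?case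
  proof (cases hs)
    case Nil
    have "ip (c *\<^sub>R x) (c *\<^sub>R x) = \<bar>c\<bar>\<^sup>2 * ip x x"
      by (simp add: scaleR_left scaleR_right power2_eq_square mult.assoc)
    moreover have "(\<bar>c\<bar>\<^sup>2) powr (q / 2) = \<bar>c\<bar> powr q"
      by (simp only: powr_numeral[OF abs_ge_zero, of c, symmetric] powr_powr) simp
    ultimately show ?thesis
      using assms dpow_Nil_powr[of "c *\<^sub>R x" q] dpow_Nil_powr[of x q]
      by (simp add: Nil powr_mult nonneg del: dpow.simps)
  next
    case (Cons h hs')
    define n where "n = length hs'"
    define K where "K = \<bar>c\<bar> powr (q - Suc n) * sgn c ^ Suc n"
    have s2: "sgn c * sgn c = 1" using assms(1) by (simp add: sgn_if)
    have c: "c = \<bar>c\<bar> powr 1 * sgn c" by (simp add: sgn_if)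
    have "ip (c *\<^sub>R x) h * dpow ip (q - 2) hs' (c *\<^sub>R x)
        = (\<bar>c\<bar> powr 1 * \<bar>c\<bar> powr (q - 2 - n)) * sgn c ^ Suc n * (ip x h * dpow ip (q - 2) hs' x)"
      using less.hyps[of hs' "q - 2"] c by (simp add: Cons n_def scaleR_left)
    also have "\<bar>c\<bar> powr 1 * \<bar>c\<bar> powr (q - 2 - n) = \<bar>c\<bar> powr (q - Suc n)"
      by (simp only: powr_add[symmetric]) (simp add: algebra_simps)
    finally have 1: "ip (c *\<^sub>R x) h * dpow ip (q - 2) hs' (c *\<^sub>R x) = K * (ip x h * dpow ip (q - 2) hs' x)"
      by (simp add: K_def)
    have "dpow ip (q - 2) ys (c *\<^sub>R x) = K * dpow ip (q - 2) ys x" if "(y, ys) \<in> set (omits hs')" for y ys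
    proof -
      have l: "n = Suc (length ys)" using length_omits[OF that] by (simp add: n_def)
      have 1: "q - 2 - real (length ys) = q - real (Suc n)" by (simp add: l)
      have 2: "sgn c ^ length ys = sgn c ^ Suc n" using s2 by (simp add: l flip: mult.assoc)
      have "length ys < length hs" using l by (simp add: Cons n_def)
      from less.hyps[OF this, of "q - 2"] show ?thesis by (simp only: 1 2 K_def)
    qed
    then have "(\<Sum>p\<leftarrow>omits hs'. ip (fst p) h * dpow ip (q - 2) (snd p) (c *\<^sub>R x))
        = (\<Sum>p\<leftarrow>omits hs'. K * (ip (fst p) h * dpow ip (q - 2) (snd p) x))"
      by (intro sum_omits_cong) simp
    then have "dpow ip q hs (c *\<^sub>R x) = K * dpow ip q hs x"
      by (simp add: Cons 1 sum_list_const_mult algebra_simps)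
    then show ?thesis by (simp add: K_def Cons n_def)
  qed
qed

lemma dpow_append_commute: "dpow ip q (xs @ ys) x = dpow ip q (ys @ xs) x"
proof (induction xs arbitrary: ys)
  case (Cons a xs)
  have "dpow ip q ((a # xs) @ ys) x = dpow ip q (xs @ (ys @ [a])) x"
    using dpow_snoc[of q "xs @ ys" a x] by simp
  also have "\<dots> = dpow ip q (ys @ (a # xs)) x" using Cons[of "ys @ [a]"] by simp
  finally show ?case .
qed simp

lemma dpow_scaleR_head: "dpow ip q ((c *\<^sub>R h) # hs) x = c * dpow ip q (h # hs) x"
  by (simp add: scaleR_right sum_list_const_mult algebra_simps)

lemma cauchy_schwarz: "\<bar>ip a b\<bar> \<le> sqrt (ip a a) * sqrt (ip b b)"
proof (cases "b = 0")
  case False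
  then have b: "ip b b > 0" by (rule pos)
  define c where "c = ip a b / ip b b"
  have "0 \<le> ip (a - c *\<^sub>R b) (a - c *\<^sub>R b)" by (rule nonneg)
  also have "\<dots> = ip a a - 2 * (c * ip a b) + c * (c * ip b b)"
    by (simp add: diff_left diff_right scaleR_left scaleR_right sym[of b a] algebra_simps)
  also have "\<dots> = ip a a - (ip a b)\<^sup>2 / ip b b"
    using b by (simp add: c_def power2_eq_square)
  finally have "(ip a b)\<^sup>2 \<le> ip a a * ip b b"
    using b by (simp add: field_simps)
  then have "sqrt ((ip a b)\<^sup>2) \<le> sqrt (ip a a * ip b b)" by (rule real_sqrt_le_mono)
  then show ?thesis by (simp add: real_sqrt_mult)
qed (simp add: zero_right)

end

section \<open>The bound in the plane\<close>

interpretation plane: inner_form "inner :: complex \<Rightarrow> complex \<Rightarrow> real"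
  by (intro inner_form.intro bounded_bilinear_inner inner_form_axioms.intro)
    (auto simp: inner_commute)

text \<open>
  For directions in the quadrant spanned by \<open>x\<close> and \<open>\<i> x\<close> all quantities in \<open>dpow_split\<close> are
  nonnegative, as the orthogonal complement of \<open>x\<close> is a line.
\<close>

lemma plane_dpow_nonneg:
  assumes "norm x = 1" "\<And>h. h \<in> set hs \<Longrightarrow> 0 \<le> inner x h \<and> 0 \<le> inner (\<i> * x) h"
    and "real (length hs) \<le> q + 1"
  shows "0 \<le> dpow inner q hs (x::complex)"
  using assms(2,3)
proof (induction "length hs" arbitrary: hs q rule: less_induct)
  case less
  have xx: "inner x x = 1" using assms(1) by (simp add: power2_norm_eq_inner[symmetric])
  show ?case
  proof (cases hs)
    case Nil
    then show ?thesis by (simp add: rpow_def)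
  next
    case (Cons h hs')
    have ortho: "inner y h - inner x y * inner x h = inner (\<i> * x) y * inner (\<i> * x) h" for y
    proof -
      have "inner y h = inner x x * inner y h" by (simp add: xx)
      then show ?thesis by (simp add: inner_complex_def algebra_simps)
    qed
    have 1: "0 \<le> (q - length hs') * inner x h * dpow inner q hs' x"
      using less.prems less.hyps[of hs' q] by (simp add: Cons)
    have "0 \<le> q * (inner (\<i> * x) (fst p) * inner (\<i> * x) h * dpow inner (q - 2) (snd p) x)"
      if p: "p \<in> set (omits hs')" for p
    proof -
      have "length hs' = Suc (length (snd p))" by (rule length_omits[OF p])
      then show ?thesis
        using less.prems less.hyps[of "snd p" "q - 2"] set_omits[OF p] by (simp add: Cons)
    qed
    then have "0 \<le> (\<Sum>p\<leftarrow>omits hs'. q * (inner (\<i> * x) (fst p) * inner (\<i> * x) h * dpow inner (q - 2) (snd p) x))"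
      by (intro sum_list_nonneg) auto
    then show ?thesis
      using 1 by (simp only: Cons plane.dpow_split[OF xx] ortho sum_list_const_mult)
  qed
qed

text \<open>
  The velocity \<open>\<i> cis t\<close> of the base point lies in the quadrant of the directions, so
  \<open>plane_dpow_nonneg\<close> applies to the derivative. That derivative has one direction more, which the
  slack \<open>q + 1\<close> in \<open>plane_dpow_nonneg\<close> allows for.
\<close>

lemma plane_dpow_mono:
  assumes "a \<le> b" "real (length hs) \<le> q"
    and "\<And>t h. a \<le> t \<Longrightarrow> t \<le> b \<Longrightarrow> h \<in> set hs \<Longrightarrow> 0 \<le> inner (cis t) h \<and> 0 \<le> inner (\<i> * cis t) h"
  shows "dpow inner q hs (cis a) \<le> dpow inner q hs (cis b)"
proof (rule DERIV_nonneg_imp_nondecreasing[OF assms(1)])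
  fix t assume t: "a \<le> t" "t \<le> b"
  have "((\<lambda>t. dpow inner q hs (cis t)) has_derivative
      (\<lambda>k. dpow inner q ((k *\<^sub>R (\<i> * cis t)) # hs) (cis t))) (at t)"
    by (rule has_derivative_compose[OF has_derivative_cis[OF has_derivative_ident]
          plane.dpow_has_derivative]) (simp add: smooth_at_def)
  then have "DERIV (\<lambda>t. dpow inner q hs (cis t)) t :> dpow inner q ((\<i> * cis t) # hs) (cis t)"
    by (simp only: plane.dpow_scaleR_head has_field_derivative_def mult.commute[of _ "dpow _ _ _ _"])
  moreover have "0 \<le> dpow inner q ((\<i> * cis t) # hs) (cis t)"
  proof (rule plane_dpow_nonneg)
    fix h assume "h \<in> set ((\<i> * cis t) # hs)"
    then show "0 \<le> inner (cis t) h \<and> 0 \<le> inner (\<i> * cis t) h"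
      using assms(3)[OF t] by (auto simp: inner_complex_def)
  qed (use assms(2) in auto)
  ultimately show "\<exists>y. DERIV (\<lambda>t. dpow inner q hs (cis t)) t :> y \<and> y \<ge> 0" by blast
qed

lemma inner_cis_rcis: "inner (cis t) (rcis r a) = r * cos (a - t)"
  "inner (\<i> * cis t) (rcis r a) = r * sin (a - t)"
  by (simp_all add: inner_complex_def cos_diff sin_diff algebra_simps)

text \<open>
  The base point is turned to the smallest of the angles, \<open>\<gamma>\<close>. Until then all directions stay in its
  quadrant, and the remaining ones still lie in the quadrant at \<open>\<gamma>\<close>.
\<close>

lemma plane_dpow_le:
  assumes "\<And>p. p \<in> set ps \<Longrightarrow> 0 \<le> fst p \<and> \<beta> \<le> snd p \<and> snd p \<le> \<beta> + pi / 2"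
    and "real (length ps) \<le> q"
  shows "dpow inner q (map (\<lambda>p. rcis (fst p) (snd p)) ps) (cis \<beta>)
    \<le> (\<Prod>i<length ps. q - real i) * prod_list (map fst ps)"
  using assms
proof (induction "length ps" arbitrary: ps \<beta>)
  case 0
  then show ?case by (simp add: rpow_def dot_square_norm)
next
  case (Suc n)
  let ?h = "\<lambda>p. rcis (fst p) (snd p)"
  define \<gamma> where "\<gamma> = Min (snd ` set ps)"
  have ne: "snd ` set ps \<noteq> {}" using Suc.hyps(2) by auto
  have "\<gamma> \<in> snd ` set ps" unfolding \<gamma>_def by (rule Min_in) (use ne in auto)
  then obtain r where "(r, \<gamma>) \<in> set ps" by auto
  then obtain ps1 ps2 where ps: "ps = ps1 @ (r, \<gamma>) # ps2" by (meson split_list)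
  have min: "\<gamma> \<le> snd p" if "p \<in> set ps" for p
    unfolding \<gamma>_def using that by simp
  have \<gamma>: "\<beta> \<le> \<gamma>" using Suc.prems(1)[of "(r, \<gamma>)"] by (simp add: ps)
  have "r \<ge> 0" using Suc.prems(1)[of "(r, \<gamma>)"] by (simp add: ps)
  have len: "length (ps2 @ ps1) = n" using Suc.hyps(2) by (simp add: ps)
  have "dpow inner q (map ?h ps) (cis \<beta>) \<le> dpow inner q (map ?h ps) (cis \<gamma>)"
  proof (rule plane_dpow_mono[OF \<gamma>])
    fix t h assume t: "\<beta> \<le> t" "t \<le> \<gamma>" and "h \<in> set (map ?h ps)"
    then obtain p where p: "p \<in> set ps" "h = ?h p" by auto
    then have "0 \<le> snd p - t" "snd p - t \<le> pi / 2" "0 \<le> fst p"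
      using min[of p] Suc.prems(1)[of p] t by auto
    then show "0 \<le> inner (cis t) h \<and> 0 \<le> inner (\<i> * cis t) h"
      unfolding p(2) inner_cis_rcis by (intro conjI mult_nonneg_nonneg cos_ge_zero sin_ge_zero) auto
  qed (use Suc.prems(2) in simp)
  also have "\<dots> = dpow inner q ((r *\<^sub>R cis \<gamma>) # map ?h (ps2 @ ps1)) (cis \<gamma>)"
    using plane.dpow_append_commute[of q "map ?h ps1" "map ?h ((r, \<gamma>) # ps2)" "cis \<gamma>"]
    by (simp add: ps rcis_def scaleR_conv_of_real del: dpow.simps)
  also have "\<dots> = (q - n) * r * dpow inner q (map ?h (ps2 @ ps1)) (cis \<gamma>)"
    by (simp only: plane.dpow_scaleR_head plane.dpow_euler[OF cis_neq_zero] length_map len)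
       (simp only: mult_ac)
  also have "\<dots> \<le> (q - n) * r * ((\<Prod>i<n. q - real i) * prod_list (map fst (ps2 @ ps1)))"
  proof (rule mult_left_mono)
    show "dpow inner q (map ?h (ps2 @ ps1)) (cis \<gamma>) \<le> (\<Prod>i<n. q - real i) * prod_list (map fst (ps2 @ ps1))"
      using Suc.hyps(1)[of "ps2 @ ps1" \<gamma>] len Suc.prems \<gamma> min Suc.hyps(2) unfolding ps by fastforce
    show "0 \<le> (q - n) * r" using \<open>r \<ge> 0\<close> Suc.prems(2) Suc.hyps(2) by simp
  qed
  also have "\<dots> = (\<Prod>i<length ps. q - real i) * prod_list (map fst ps)"
    by (simp add: Suc.hyps(2)[symmetric]) (simp add: ps)
  finally show ?case .
qed

section \<open>The bound in arbitrary dimension\<close>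

context inner_form
begin

text \<open>
  The direction \<open>h\<close> in the coordinates \<open>\<bar>\<tau>\<bar>\<close> and \<open>\<parallel>w\<parallel>\<close>, where \<open>h = \<tau> e + w\<close> with \<open>w\<close> orthogonal to
  the unit vector \<open>e\<close>; the norm of \<open>h\<close> is kept.
\<close>

definition to_plane :: "'a \<Rightarrow> 'a \<Rightarrow> complex" where
  "to_plane e h = Complex \<bar>ip e h\<bar> (sqrt (ip h h - (ip e h)\<^sup>2))"

text \<open>
  Both sides satisfy the recursion \<open>dpow_split\<close> with the same nonnegative coefficients, and in the
  plane the Cauchy-Schwarz inequality for the orthogonal parts is an equality.
\<close>

lemma abs_dpow_le_plane:
  assumes e: "ip e e = 1" and q: "real (length hs) \<le> q + 1"
  shows "\<bar>dpow ip q hs e\<bar> \<le> dpow inner q (map (to_plane e) hs) 1"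
  using q
proof (induction "length hs" arbitrary: hs q rule: less_induct)
  case less
  show ?case
  proof (cases hs)
    case Nil
    then show ?thesis using e by (simp add: rpow_def)
  next
    case (Cons h hs')
    let ?z = "to_plane e"
    have cross: "\<bar>ip y h - ip e y * ip e h\<bar> \<le> Im (?z y) * Im (?z h)" for y
    proof -
      have "ip (u - ip e u *\<^sub>R e) (v - ip e v *\<^sub>R e) = ip u v - ip e u * ip e v" for u v
        by (simp add: diff_left diff_right scaleR_left scaleR_right e sym[of u e] algebra_simps)
      then show ?thesis
        using cauchy_schwarz[of "y - ip e y *\<^sub>R e" "h - ip e h *\<^sub>R e"]
        by (simp add: to_plane_def power2_eq_square)
    qed
    have n: "real (length hs') \<le> q" using less.prems by (simp add: Cons)
    have "\<bar>(q - length hs') * ip e h * dpow ip q hs' e\<bar>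
        \<le> (q - length hs') * Re (?z h) * dpow inner q (map ?z hs') 1"
      using n less.hyps[of hs' q] by (simp add: Cons abs_mult to_plane_def mult_left_mono)
    moreover have "\<bar>q * ((ip (fst p) h - ip e (fst p) * ip e h) * dpow ip (q - 2) (snd p) e)\<bar>
        \<le> q * (Im (?z (fst p)) * Im (?z h) * dpow inner (q - 2) (map ?z (snd p)) 1)"
      if p: "p \<in> set (omits hs')" for p
    proof -
      have l: "length hs' = Suc (length (snd p))" by (rule length_omits[OF p])
      have "\<bar>dpow ip (q - 2) (snd p) e\<bar> \<le> dpow inner (q - 2) (map ?z (snd p)) 1"
        using less.hyps[of "snd p" "q - 2"] n l by (simp add: Cons)
      then have "\<bar>ip (fst p) h - ip e (fst p) * ip e h\<bar> * \<bar>dpow ip (q - 2) (snd p) e\<bar>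
          \<le> Im (?z (fst p)) * Im (?z h) * dpow inner (q - 2) (map ?z (snd p)) 1"
        using cross[of "fst p"] by (intro mult_mono) (auto intro: order_trans[OF abs_ge_zero])
      moreover have "0 \<le> q" using n by linarith
      ultimately show ?thesis by (simp add: abs_mult mult_left_mono)
    qed
    then have "\<bar>\<Sum>p\<leftarrow>omits hs'. q * ((ip (fst p) h - ip e (fst p) * ip e h) * dpow ip (q - 2) (snd p) e)\<bar>
        \<le> (\<Sum>p\<leftarrow>omits hs'. q * (Im (?z (fst p)) * Im (?z h) * dpow inner (q - 2) (map ?z (snd p)) 1))"
      by (intro order_trans[OF sum_list_abs] ) (auto simp: o_def intro!: sum_list_mono)
    ultimately have "\<bar>dpow ip q (h # hs') e\<bar>
        \<le> (q - length hs') * Re (?z h) * dpow inner q (map ?z hs') 1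
        + (\<Sum>p\<leftarrow>omits hs'. q * (Im (?z (fst p)) * Im (?z h) * dpow inner (q - 2) (map ?z (snd p)) 1))"
      unfolding dpow_split[OF e] sum_list_const_mult by linarith
    also have "\<dots> = dpow inner q (map ?z hs) 1"
    proof -
      have 1: "inner 1 (1::complex) = 1" by (simp add: inner_complex_def)
      show ?thesis
        unfolding Cons list.map plane.dpow_split[OF 1] sum_list_const_mult
        by (simp add: omits_map o_def inner_complex_def)
    qed
    finally show ?thesis by (simp only: Cons)
  qed
qed

theorem abs_dpow_le:
  assumes "x \<noteq> 0" "real (length hs) \<le> q"
  shows "\<bar>dpow ip q hs x\<bar> \<le> (\<Prod>i<length hs. q - real i) * prod_list (map (\<lambda>h. sqrt (ip h h)) hs)
           * sqrt (ip x x) powr (q - length hs)"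
proof -
  define t where "t = sqrt (ip x x)"
  have t: "t > 0" using pos[OF assms(1)] by (simp add: t_def)
  have tt: "t * t = ip x x" using nonneg[of x] by (simp add: t_def)
  define e where "e = (1 / t) *\<^sub>R x"
  have x: "x = t *\<^sub>R e" using t by (simp add: e_def)
  have e: "ip e e = 1" using t by (simp add: e_def scaleR_left scaleR_right flip: tt)
  have "e \<noteq> 0" using assms(1) x by auto
  let ?p = "\<lambda>h. (sqrt (ip h h), Arg (to_plane e h))"
  have z: "to_plane e h = rcis (sqrt (ip h h)) (Arg (to_plane e h))"
    "0 \<le> Arg (to_plane e h)" "Arg (to_plane e h) \<le> pi / 2" for h
  proof -
    have "(ip e h)\<^sup>2 \<le> ip h h"
      using power_mono[OF cauchy_schwarz[of e h] abs_ge_zero, of 2] by (simp add: e nonneg)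
    then have "cmod (to_plane e h) = sqrt (ip h h)"
      by (simp add: to_plane_def cmod_def)
    then show "to_plane e h = rcis (sqrt (ip h h)) (Arg (to_plane e h))"
      by (metis rcis_cmod_Arg)
    show "0 \<le> Arg (to_plane e h)"
      using \<open>(ip e h)\<^sup>2 \<le> ip h h\<close> by (simp add: Arg_less_0 to_plane_def)
    have "\<bar>Arg (to_plane e h)\<bar> \<le> pi / 2" by (simp only: Arg_Re_nonneg) (simp add: to_plane_def)
    then show "Arg (to_plane e h) \<le> pi / 2" by simp
  qed
  have "\<bar>dpow ip q hs e\<bar> \<le> dpow inner q (map (to_plane e) hs) 1"
    by (rule abs_dpow_le_plane[OF e]) (use assms(2) in simp)
  also have "map (to_plane e) hs = map (\<lambda>p. rcis (fst p) (snd p)) (map ?p hs)"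
    using z(1) by simp
  also have "dpow inner q \<dots> 1 \<le> (\<Prod>i<length (map ?p hs). q - real i) * prod_list (map fst (map ?p hs))"
    unfolding cis_zero[symmetric]
    by (rule plane_dpow_le) (use z assms(2) nonneg in auto)
  finally have "\<bar>dpow ip q hs e\<bar> \<le> (\<Prod>i<length hs. q - real i) * prod_list (map (\<lambda>h. sqrt (ip h h)) hs)"
    by (simp add: o_def)
  then have "t powr (q - length hs) * \<bar>dpow ip q hs e\<bar>
      \<le> t powr (q - length hs) * ((\<Prod>i<length hs. q - real i) * prod_list (map (\<lambda>h. sqrt (ip h h)) hs))"
    by (intro mult_left_mono) auto
  moreover have "dpow ip q hs x = t powr (q - length hs) * dpow ip q hs e"
    using dpow_scaleR[of t e q hs] t \<open>e \<noteq> 0\<close> by (simp flip: x)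
  ultimately show ?thesis unfolding t_def[symmetric] by (simp add: abs_mult mult_ac)
qed

end

section \<open>Hoelder continuity of signed powers\<close>

lemma powr_add_le:
  fixes x y \<nu> :: real
  assumes "0 \<le> x" "0 \<le> y" "0 < \<nu>" "\<nu> \<le> 1"
  shows "(x + y) powr \<nu> \<le> x powr \<nu> + y powr \<nu>"
proof (cases "x + y = 0")
  case False
  then have s: "x + y > 0" using assms by linarith
  \<comment> \<open>On the unit interval, powers with exponent at most 1 dominate the identity.\<close>
  have *: "u / (x + y) \<le> (u / (x + y)) powr \<nu>" if "0 \<le> u" "u \<le> x + y" for u
    using powr_mono'[of \<nu> 1 "u / (x + y)"] that s assms(4) by simp
  have "1 = x / (x + y) + y / (x + y)" using s by (simp flip: add_divide_distrib)
  also have "\<dots> \<le> (x / (x + y)) powr \<nu> + (y / (x + y)) powr \<nu>"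
    using assms by (intro add_mono *) auto
  also have "\<dots> = (x powr \<nu> + y powr \<nu>) / (x + y) powr \<nu>"
    using assms s by (simp add: powr_divide add_divide_distrib)
  finally show ?thesis using s by (simp add: field_simps)
qed (use assms in simp)

lemma abs_powr_diff_le:
  fixes a b \<nu> :: real
  assumes "0 < \<nu>" "\<nu> \<le> 1"
  shows "\<bar>\<bar>b\<bar> powr \<nu> - \<bar>a\<bar> powr \<nu>\<bar> \<le> \<bar>b - a\<bar> powr \<nu>"
proof -
  have *: "\<bar>b\<bar> powr \<nu> \<le> \<bar>a\<bar> powr \<nu> + \<bar>b - a\<bar> powr \<nu>" for a b :: real
  proof -
    have "\<bar>b\<bar> powr \<nu> \<le> (\<bar>a\<bar> + \<bar>b - a\<bar>) powr \<nu>"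
      using assms by (intro powr_mono2) auto
    also have "\<dots> \<le> \<bar>a\<bar> powr \<nu> + \<bar>b - a\<bar> powr \<nu>"
      using assms by (intro powr_add_le) auto
    finally show ?thesis .
  qed
  show ?thesis using *[of b a] *[of a b] by (simp add: abs_le_iff abs_minus_commute)
qed

text \<open>
  Concavity of \<open>t \<mapsto> t\<^sup>\<nu>\<close>, applied to the midpoint \<open>m\<close> of \<open>x\<close> and \<open>y\<close>.
\<close>

lemma powr_add_powr_le:
  fixes x y \<nu> :: real
  assumes "0 \<le> x" "0 \<le> y" "0 \<le> \<nu>" "\<nu> \<le> 1"
  shows "x powr \<nu> + y powr \<nu> \<le> 2 powr (1 - \<nu>) * rpow (x + y) \<nu>"
proof (cases "x + y = 0 \<or> \<nu> = 0")
  case False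
  define m where "m = (x + y) / 2"
  have m: "m > 0" using False assms by (auto simp: m_def)
  \<comment> \<open>The graph of the power lies below its tangent at 1.\<close>
  have *: "(u / m) powr \<nu> \<le> \<nu> * (u / m) + (1 - \<nu>)" if "0 \<le> u" for u
    using Youngs_inequality_0[of \<nu> "1 - \<nu>" "u / m" 1] that m assms by (cases "u = 0") auto
  have "x + y = 2 * m" by (simp add: m_def)
  then have "x / m + y / m = 2" using m by (simp add: add_divide_distrib[symmetric])
  then have "\<nu> * (x / m) + \<nu> * (y / m) = \<nu> * 2" by (simp only: distrib_left[symmetric])
  then have "(x / m) powr \<nu> + (y / m) powr \<nu> \<le> 2"
    using *[OF assms(1)] *[OF assms(2)] by linarith
  then have "(x powr \<nu> + y powr \<nu>) / m powr \<nu> \<le> 2"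
    using assms m by (simp add: powr_divide add_divide_distrib)
  then have "x powr \<nu> + y powr \<nu> \<le> 2 * m powr \<nu>"
    using m by (simp add: field_simps)
  also have "\<dots> = 2 powr (1 - \<nu>) * (x + y) powr \<nu>"
    using assms by (simp add: m_def powr_divide powr_diff)
  finally show ?thesis using False by (simp add: rpow_def)
qed (use assms in \<open>auto simp: rpow_def powr_def\<close>)

text \<open>
  With \<open>powr\<close> the signed power vanishes at 0, also for \<open>\<nu> = 0\<close>. For even \<open>p\<close> and \<open>\<nu> = 0\<close> this
  introduces a jump of height 1 at the origin that the extension by continuity does not have. That case is
  excluded here and treated apart below.
\<close>

lemma signed_powr_hoelder:
  fixes a b \<nu> :: real
  assumes "0 \<le> \<nu>" "\<nu> \<le> 1" "\<not> (\<nu> = 0 \<and> even p)"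
  shows "\<bar>\<bar>b\<bar> powr \<nu> * sgn b ^ p - \<bar>a\<bar> powr \<nu> * sgn a ^ p\<bar>
    \<le> (if even p then 1 else 2 powr (1 - \<nu>)) * rpow \<bar>b - a\<bar> \<nu>"
proof (cases "even p")
  case True
  then have s: "\<bar>c\<bar> powr \<nu> * sgn c ^ p = \<bar>c\<bar> powr \<nu>" for c
    by (cases "c = 0") (auto simp: sgn_if)
  show ?thesis
    unfolding s using abs_powr_diff_le[of \<nu> b a] assms True by (simp add: rpow_def)
next
  case False
  have s: "sgn c ^ p = sgn c" for c :: real using False by (auto simp: sgn_if elim: oddE)
  have one: "1 \<le> 2 powr (1 - \<nu>)" using assms by (intro ge_one_powr_ge_zero) auto
  show ?thesis
  proof (cases "a * b > 0")
    case True
    then have "sgn a = sgn b" "sgn b = 1 \<or> sgn b = - 1" by (auto simp: zero_less_mult_iff)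
    then have "\<bar>\<bar>b\<bar> powr \<nu> * sgn b ^ p - \<bar>a\<bar> powr \<nu> * sgn a ^ p\<bar> = \<bar>\<bar>b\<bar> powr \<nu> - \<bar>a\<bar> powr \<nu>\<bar>"
      unfolding s by auto
    also have "\<dots> \<le> rpow \<bar>b - a\<bar> \<nu>"
      using abs_powr_diff_le[of \<nu> b a] assms True by (cases "\<nu> = 0") (auto simp: rpow_def)
    also have "\<dots> \<le> 2 powr (1 - \<nu>) * rpow \<bar>b - a\<bar> \<nu>"
      using mult_right_mono[OF one, of "rpow \<bar>b - a\<bar> \<nu>"] by (simp add: rpow_def)
    finally show ?thesis using False by simp
  next
    case opp: False
    then have "\<bar>b\<bar> + \<bar>a\<bar> = \<bar>b - a\<bar>" by (auto simp: zero_less_mult_iff abs_if)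
    moreover have "\<bar>\<bar>c\<bar> powr \<nu> * sgn c\<bar> \<le> \<bar>c\<bar> powr \<nu>" for c
      by (simp add: abs_mult abs_sgn_eq)
    then have "\<bar>\<bar>b\<bar> powr \<nu> * sgn b ^ p - \<bar>a\<bar> powr \<nu> * sgn a ^ p\<bar> \<le> \<bar>b\<bar> powr \<nu> + \<bar>a\<bar> powr \<nu>"
      unfolding s by (intro order_trans[OF abs_triangle_ineq4] add_mono)
    ultimately show ?thesis
      using powr_add_powr_le[of "\<bar>b\<bar>" "\<bar>a\<bar>" \<nu>] assms False by simp
  qed
qed

section \<open>Iterated derivatives of a power of the norm\<close>

locale euclidean_form = inner_form ip
  for ip :: "'a::euclidean_space \<Rightarrow> 'a \<Rightarrow> real"
begin

lemma iter_deriv_dpow: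
  assumes S: "open S" "\<And>x. x \<in> S \<Longrightarrow> smooth_at q x" and "x \<in> S"
  shows "iter_deriv (dpow ip q []) hs x = dpow ip q hs x"
    and "(iter_deriv (dpow ip q []) hs has_derivative (\<lambda>k. dpow ip q (k # hs) x)) (at x)"
proof -
  have deriv: "(iter_deriv (dpow ip q []) hs has_derivative (\<lambda>k. dpow ip q (k # hs) x)) (at x)"
    if "\<And>x. x \<in> S \<Longrightarrow> iter_deriv (dpow ip q []) hs x = dpow ip q hs x" "x \<in> S" for hs x
    by (rule has_derivative_transform_within_open[OF dpow_has_derivative[OF S(2)] S(1)])
      (use that in auto)
  have eq: "x \<in> S \<Longrightarrow> iter_deriv (dpow ip q []) hs x = dpow ip q hs x" for x
  proof (induction hs arbitrary: x)
    case (Cons h hs)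
    from frechet_derivative_at[OF deriv[OF Cons.IH Cons.prems], symmetric]
    show ?case by (simp del: dpow.simps)
  qed simp
  show "iter_deriv (dpow ip q []) hs x = dpow ip q hs x" by (rule eq[OF \<open>x \<in> S\<close>])
  show "(iter_deriv (dpow ip q []) hs has_derivative (\<lambda>k. dpow ip q (k # hs) x)) (at x)"
    by (rule deriv[OF eq \<open>x \<in> S\<close>])
qed

lemma times_differentiable_dpow:
  assumes S: "open S" "\<And>x. x \<in> S \<Longrightarrow> smooth_at q x" and "x \<in> S"
  shows "times_differentiable_at k (dpow ip q []) x"
  using \<open>x \<in> S\<close>
proof (induction k arbitrary: x)
  case (Suc k)
  have "\<forall>\<^sub>F y in nhds x. y \<in> S" using S(1) Suc.prems by (rule eventually_nhds_in_open)
  then have "\<forall>\<^sub>F y in nhds x. times_differentiable_at k (dpow ip q []) y"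
    by (rule eventually_mono) (rule Suc.IH)
  moreover have "iter_deriv (dpow ip q []) hs differentiable at x" for hs
    using iter_deriv_dpow(2)[OF S Suc.prems] by (rule differentiableI)
  ultimately show ?case by (simp del: dpow.simps)
qed simp

lemma smooth_off_zero: "open (- {0::'a})" "x \<in> - {0::'a} \<Longrightarrow> smooth_at q x"
  by (auto simp: smooth_at_def)

lemma has_derivative_zero_of_bound:
  assumes g0: "g 0 = 0" and r: "1 < r"
    and bound: "\<And>y. y \<noteq> 0 \<Longrightarrow> \<bar>g y :: real\<bar> \<le> C * sqrt (ip y y) powr r"
  shows "(g has_derivative (\<lambda>_. 0)) (at 0)"
proof -
  obtain K where K: "K > 0" "\<And>a b. \<bar>ip a b\<bar> \<le> norm a * norm b * K"
    using pos_bounded by (auto simp: real_norm_def)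
  have "((\<lambda>h. norm (g (0 + h) - g 0 - 0) / norm h) \<longlongrightarrow> 0) (at 0)"
  proof (rule Lim_null_comparison)
    have "norm (norm (g (0 + h) - g 0 - 0) / norm h)
        \<le> \<bar>C\<bar> * sqrt K powr r * norm h powr (r - 1)" if "h \<noteq> 0" for h
    proof -
      have "sqrt (ip h h) \<le> sqrt (norm h * norm h * K)"
        using K(2)[of h h] by (intro real_sqrt_le_mono) simp
      also have "\<dots> = sqrt K * norm h" by (simp add: real_sqrt_mult)
      finally have "sqrt (ip h h) powr r \<le> (sqrt K * norm h) powr r"
        using r nonneg by (intro powr_mono2) auto
      also have "\<dots> = sqrt K powr r * (norm h powr (r - 1) * norm h)"
        using K(1) that by (simp add: powr_mult powr_diff)
      finally have "\<bar>g h\<bar> \<le> \<bar>C\<bar> * (sqrt K powr r * (norm h powr (r - 1) * norm h))"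
        using bound[OF that] by (meson abs_ge_self mult_mono order_trans abs_ge_zero powr_ge_zero)
      then show ?thesis using that by (simp add: g0 field_simps)
    qed
    then show "\<forall>\<^sub>F h in at 0. norm (norm (g (0 + h) - g 0 - 0) / norm h)
        \<le> \<bar>C\<bar> * sqrt K powr r * norm h powr (r - 1)"
      by (auto simp: eventually_at_filter)
    have "((\<lambda>h::'a. norm h powr (r - 1)) \<longlongrightarrow> 0) (at 0)"
      using r by (intro tendsto_zero_powrI[of _ _ _ "r - 1"] tendsto_norm_zero tendsto_ident_at tendsto_const) auto
    then show "((\<lambda>h::'a. \<bar>C\<bar> * sqrt K powr r * norm h powr (r - 1)) \<longlongrightarrow> 0) (at 0)"
      by (rule tendsto_mult_right_zero)
  qed
  then show ?thesis by (simp add: has_derivative_at)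
qed

lemma iter_deriv_at_zero:
  assumes "real (length hs) < q"
  shows "iter_deriv (dpow ip q []) hs 0 = 0"
    and "real (length hs) + 1 < q \<Longrightarrow>
      (iter_deriv (dpow ip q []) hs has_derivative (\<lambda>_. 0)) (at 0)"
proof -
  have deriv: "(iter_deriv (dpow ip q []) hs has_derivative (\<lambda>_. 0)) (at 0)"
    if "iter_deriv (dpow ip q []) hs 0 = 0" "real (length hs) + 1 < q" for hs
  proof (rule has_derivative_zero_of_bound[where r = "q - real (length hs)"])
    show "iter_deriv (dpow ip q []) hs 0 = 0" by (rule that(1))
    show "1 < q - real (length hs)" using that(2) by simp
    fix y :: 'a assume y: "y \<noteq> 0"
    show "\<bar>iter_deriv (dpow ip q []) hs y\<bar>
      \<le> (\<Prod>i<length hs. q - real i) * prod_list (map (\<lambda>h. sqrt (ip h h)) hs) * sqrt (ip y y) powr (q - length hs)"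
      using abs_dpow_le[OF y, of hs q] that(2) y
        iter_deriv_dpow(1)[OF smooth_off_zero, of y q hs] by simp
  qed
  have zero: "real (length hs) < q \<Longrightarrow> iter_deriv (dpow ip q []) hs 0 = 0" for hs
  proof (induction hs)
    case Nil
    then show ?case by (simp add: rpow_def zero_left)
  next
    case (Cons h hs)
    then have "(iter_deriv (dpow ip q []) hs has_derivative (\<lambda>_. 0)) (at 0)"
      by (intro deriv) (auto simp del: dpow.simps)
    from frechet_derivative_at[OF this, symmetric] show ?case by (simp del: dpow.simps)
  qed
  show "iter_deriv (dpow ip q []) hs 0 = 0" by (rule zero[OF assms])
  show "real (length hs) + 1 < q \<Longrightarrow>
      (iter_deriv (dpow ip q []) hs has_derivative (\<lambda>_. 0)) (at 0)"
    by (rule deriv[OF zero[OF assms]])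
qed

text \<open>
  All powers with \<open>k < q\<close> are covered, at the origin too: there the derivatives of order below \<open>q\<close>
  vanish, and those of order below \<open>q - 1\<close> are differentiable as they are \<open>O(\<parallel>x\<parallel>\<^sup>r)\<close> with \<open>r > 1\<close>.
\<close>

lemma times_differentiable_below:
  assumes "real k < q"
  shows "times_differentiable_at k (dpow ip q []) x"
  using assms
proof (induction k arbitrary: x)
  case (Suc k)
  have "iter_deriv (dpow ip q []) hs differentiable at x" if "length hs = k" for hs
  proof (cases "x = 0")
    case True
    then show ?thesis using iter_deriv_at_zero(2)[of hs q] that Suc.prems
      by (auto intro: differentiableI)
  next
    case False
    then show ?thesis using iter_deriv_dpow(2)[OF smooth_off_zero, of x q hs]
      by (auto intro: differentiableI)
  qed
  moreover have "times_differentiable_at k (dpow ip q []) y" for y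
    using Suc by (simp del: dpow.simps)
  ultimately show ?case by (simp del: dpow.simps)
qed simp

lemma dpow_even_eq_0: "length hs > 2 * m \<Longrightarrow> dpow ip (2 * real m) hs x = 0"
proof (induction "length hs" arbitrary: hs m rule: less_induct)
  case less
  then obtain h hs' where hs: "hs = h # hs'" by (cases hs) auto
  show ?case
  proof (cases m)
    case (Suc m')
    have "dpow ip (2 * real m') ys x = 0" if "length ys < length hs" "2 * m' < length ys" for ys
      using less.hyps that by blast
    then have "dpow ip (2 * real m') hs' x = 0"
      "\<And>p. p \<in> set (omits hs') \<Longrightarrow> dpow ip (2 * real m') (snd p) x = 0"
      using less.prems by (auto simp: hs Suc dest: length_omits)
    then show ?thesis by (simp add: hs Suc cong: map_cong)
  qed (simp add: hs)
qed

text \<open>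
  The derivative of order \<open>2 m\<close> of the polynomial \<open>\<parallel>x\<parallel>\<^sup>2\<^sup>m\<close> is constant. The proof uses only the recursion,
  so it covers the origin.
\<close>

lemma dpow_even_const: "length hs = 2 * m \<Longrightarrow> dpow ip (2 * real m) hs x = dpow ip (2 * real m) hs y"
proof (induction "length hs" arbitrary: hs m rule: less_induct)
  case less
  show ?case
  proof (cases m)
    case 0
    then show ?thesis using less.prems by (simp add: rpow_def)
  next
    case (Suc m')
    then obtain h hs' where hs: "hs = h # hs'" using less.prems by (cases hs) auto
    have "dpow ip (2 * real m') hs' z = 0" for z
      by (rule dpow_even_eq_0) (use less.prems in \<open>simp add: hs Suc\<close>)
    moreover have "dpow ip (2 * real m') (snd p) x = dpow ip (2 * real m') (snd p) y"
      if "p \<in> set (omits hs')" for p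
      using less.hyps[of "snd p" m'] less.prems length_omits[OF that] by (simp add: hs Suc)
    ultimately show ?thesis by (simp add: hs Suc cong: map_cong)
  qed
qed

text \<open>
  For \<open>\<nu> = 0\<close> and odd \<open>p\<close> there is no need to know whether the \<open>p\<close>-th derivative exists at the origin.
  The derivative of order \<open>p - 1\<close> is an even function, so its derivative at the origin, if there is one,
  is zero.
\<close>

lemma D_at_zero:
  assumes "0 \<le> \<nu>" "\<not> (\<nu> = 0 \<and> even p)" "length hs = p"
  shows "D p (dpow ip (real p + \<nu>) []) 0 hs = 0"
proof (cases "\<nu> = 0")
  case False
  then show ?thesis using iter_deriv_at_zero(1)[of hs "real p + \<nu>"] assms by (simp add: D_def)
next
  case True
  let ?f = "dpow ip (real p) []"
  show ?thesis
  proof (cases "times_differentiable_at p ?f 0")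
    case d: True
    obtain h hs' where hs: "hs = h # hs'" using assms True by (cases hs) auto
    then have p: "p = Suc (length hs')" using assms(3) by simp
    let ?g = "iter_deriv ?f hs'"
    have "?g differentiable at 0" using d by (simp add: p)
    then obtain G where G: "(?g has_derivative G) (at 0)" by (auto simp: differentiable_def)
    have "even (length hs')" using assms(2) True p by simp
    then have "?g (- y) = ?g y" for y
      using dpow_scaleR[of "-1" y "real p" hs'] iter_deriv_dpow(1)[OF smooth_off_zero, of y "real p" hs']
        iter_deriv_dpow(1)[OF smooth_off_zero, of "- y" "real p" hs']
      by (cases "y = 0") auto
    then have e: "(\<lambda>y. ?g (- y)) = ?g" by auto
    have "((\<lambda>y. ?g (- y)) has_derivative (\<lambda>k. G (- k))) (at 0)"
      by (rule has_derivative_compose[of uminus uminus]) (use G in \<open>auto intro!: derivative_eq_intros simp del: dpow.simps\<close>)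
    then have "G = (\<lambda>k. G (- k))" unfolding e by (rule has_derivative_unique[OF G])
    then have "G h = G (- h)" by (rule fun_cong)
    also have "\<dots> = - G h"
      using has_derivative_bounded_linear[OF G] by (simp add: bounded_linear.linear linear_neg)
    finally have "G h = 0" by simp
    moreover have "frechet_derivative ?g (at 0) = G" using frechet_derivative_at[OF G] by simp
    ultimately show ?thesis using d True by (simp add: D_def hs)
  qed (use True in \<open>simp add: D_def\<close>)
qed

section \<open>Hoelder continuity along a line\<close>

lemma D_dpow_diff_le:
  assumes \<nu>: "0 \<le> \<nu>" "\<nu> \<le> 1" and u: "u \<noteq> 0" and len: "length hs = p"
    and unit: "\<And>h. h \<in> set hs \<Longrightarrow> sqrt (ip h h) = 1"
  defines "f \<equiv> dpow ip (real p + \<nu>) []"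
  shows "\<bar>D p f (b *\<^sub>R u) hs - D p f (a *\<^sub>R u) hs\<bar>
     \<le> C_const p \<nu> * rpow (\<bar>b - a\<bar> * sqrt (ip u u)) \<nu>"
proof (cases "\<nu> = 0 \<and> even p")
  case True
  then obtain m where m: "p = 2 * m" by (auto elim: evenE)
  have f: "f = dpow ip (2 * real m) []" using True by (simp add: f_def m)
  have S: "open (UNIV::'a set)" "\<And>x::'a. x \<in> UNIV \<Longrightarrow> smooth_at (2 * real m) x"
    by (auto simp: smooth_at_def)
  have "D p f x hs = dpow ip (2 * real m) hs x" for x
    using iter_deriv_dpow(1)[OF S, of x hs] times_differentiable_dpow[OF S, of x p] by (simp add: D_def f)
  then have "D p f (b *\<^sub>R u) hs = D p f (a *\<^sub>R u) hs"
    using dpow_even_const[of hs m "b *\<^sub>R u" "a *\<^sub>R u"] len m by simp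
  moreover have "0 \<le> C_const p \<nu>" using \<nu> by (simp add: C_const_def prod_nonneg)
  ultimately show ?thesis by (simp add: rpow_def)
next
  case False
  define P where "P = dpow ip (real p + \<nu>) hs u"
  define Q where "Q = (\<Prod>i=1..p. \<nu> + real i)"
  define c where "c = (if even p then 1 else 2 powr (1 - \<nu>))"
  define t where "t = sqrt (ip u u)"
  have t: "t > 0" using pos[OF u] by (simp add: t_def)
  have "Q \<ge> 0" using \<nu> by (simp add: Q_def prod_nonneg)
  have C: "C_const p \<nu> = c * Q" by (simp add: C_const_def c_def Q_def)
  have D: "D p f (s *\<^sub>R u) hs = \<bar>s\<bar> powr \<nu> * sgn s ^ p * P" for s
  proof (cases "s = 0")
    case True
    then show ?thesis using D_at_zero[OF \<nu>(1) False len] by (simp add: f_def)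
  next
    case s: False
    then have "s *\<^sub>R u \<in> - {0}" using u by simp
    from iter_deriv_dpow(1)[OF smooth_off_zero this] times_differentiable_dpow[OF smooth_off_zero this]
    show ?thesis using dpow_scaleR[OF s u, of "real p + \<nu>" hs] by (simp add: D_def f_def P_def len)
  qed
  have "(\<Prod>i<p. real p + \<nu> - real i) = Q"
    unfolding Q_def
    by (rule prod.reindex_bij_witness[of _ "\<lambda>i. p - i" "\<lambda>i. p - i"]) auto
  moreover have "prod_list (map (\<lambda>h. sqrt (ip h h)) hs) = 1"
    using unit by (induction hs) auto
  ultimately have P: "\<bar>P\<bar> \<le> Q * t powr \<nu>"
    using abs_dpow_le[OF u, of hs "real p + \<nu>"] \<nu> by (simp add: len P_def t_def)
  have "\<bar>D p f (b *\<^sub>R u) hs - D p f (a *\<^sub>R u) hs\<bar>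
      = \<bar>\<bar>b\<bar> powr \<nu> * sgn b ^ p - \<bar>a\<bar> powr \<nu> * sgn a ^ p\<bar> * \<bar>P\<bar>"
    unfolding D by (simp add: abs_mult left_diff_distrib[symmetric])
  also have "\<dots> \<le> (c * rpow \<bar>b - a\<bar> \<nu>) * (Q * t powr \<nu>)"
    unfolding c_def by (intro mult_mono signed_powr_hoelder \<nu> False P)
      (auto simp: rpow_def)
  also have "\<dots> = c * Q * rpow (\<bar>b - a\<bar> * t) \<nu>"
    using t by (auto simp: rpow_def powr_mult)
  finally show ?thesis by (simp only: C t_def)
qed

end

theorem theorem6p2:
  fixes B :: "'a::euclidean_space \<Rightarrow> ('a \<Rightarrow>\<^sub>L real)" and p :: nat and \<nu> :: real
  assumes "self_adjoint_pos_def B" and "0 \<le> \<nu>" and "\<nu> \<le> 1"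
  shows "(\<forall>x. \<not> (x = 0 \<and> \<nu> = 0 \<and> odd p) \<longrightarrow>
            times_differentiable_at p (norm_power B (real p + \<nu>)) x) \<and>
         (\<forall>u x\<^sub>1 x\<^sub>2. u \<noteq> 0 \<and> x\<^sub>1 \<in> span {u} \<and> x\<^sub>2 \<in> span {u} \<longrightarrow>
            form_norm B p (\<lambda>hs. D p (norm_power B (real p + \<nu>)) x\<^sub>2 hs
                              - D p (norm_power B (real p + \<nu>)) x\<^sub>1 hs)
              \<le> C_const p \<nu> * rpow (op_norm B (x\<^sub>2 - x\<^sub>1)) \<nu>)"
proof -
  define ip where "ip = (\<lambda>x y. blinfun_apply (B x) y)"
  have lin: "linear B" using assms(1) by (simp add: self_adjoint_pos_def_def)
  interpret euclidean_form ip
  proof (intro euclidean_form.intro inner_form.intro inner_form_axioms.intro)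
    show "bounded_bilinear ip"
      unfolding ip_def
      by (rule bounded_bilinear.comp1[OF bounded_bilinear_blinfun_apply])
        (use lin in \<open>rule linear_conv_bounded_linear[THEN iffD1]\<close>)
  qed (use assms(1) in \<open>auto simp: self_adjoint_pos_def_def ip_def\<close>)
  have f: "norm_power B q = dpow ip q []" for q
    by (simp add: fun_eq_iff norm_power_def op_norm_def ip_def)
  have nrm: "op_norm B x = sqrt (ip x x)" for x by (simp add: op_norm_def ip_def)
  have "times_differentiable_at p (dpow ip (real p + \<nu>) []) x"
    if "\<not> (x = 0 \<and> \<nu> = 0 \<and> odd p)" for x
  proof (cases "\<nu> = 0")
    case False
    then show ?thesis using assms(2) by (intro times_differentiable_below) simp
  next
    case True
    \<comment> \<open>For even \<open>p\<close> the function is a polynomial, otherwise the origin is excluded.\<close>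
    let ?S = "if even p then UNIV else - {0::'a}"
    have "open ?S" by (simp add: open_Compl)
    moreover have "smooth_at (real p + \<nu>) y" if "y \<in> ?S" for y
      using that True by (auto simp: smooth_at_def elim!: evenE split: if_splits)
    moreover have "x \<in> ?S" using that True by auto
    ultimately show ?thesis by (rule times_differentiable_dpow)
  qed
  moreover have "form_norm B p (\<lambda>hs. D p (dpow ip (real p + \<nu>) []) x\<^sub>2 hs
                              - D p (dpow ip (real p + \<nu>) []) x\<^sub>1 hs)
              \<le> C_const p \<nu> * rpow (op_norm B (x\<^sub>2 - x\<^sub>1)) \<nu>"
    if u: "u \<noteq> 0" and "x\<^sub>1 \<in> span {u}" "x\<^sub>2 \<in> span {u}" for u x\<^sub>1 x\<^sub>2
  proof -
    obtain a b where x: "x\<^sub>1 = a *\<^sub>R u" "x\<^sub>2 = b *\<^sub>R u"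
      using \<open>x\<^sub>1 \<in> span {u}\<close> \<open>x\<^sub>2 \<in> span {u}\<close> by (auto simp: span_singleton)
    have "op_norm B (x\<^sub>2 - x\<^sub>1) = sqrt ((b - a)\<^sup>2 * ip u u)"
      by (simp add: nrm x scaleR_left scaleR_right power2_eq_square mult.assoc flip: scaleR_left_diff_distrib)
    then have n: "op_norm B (x\<^sub>2 - x\<^sub>1) = \<bar>b - a\<bar> * sqrt (ip u u)"
      by (simp add: real_sqrt_mult)
    let ?U = "{hs. length hs = p \<and> (\<forall>h\<in>set hs. op_norm B h = 1)}"
    \<comment> \<open>A unit vector, so that the supremum ranges over a nonempty set.\<close>
    define e where "e = (1 / sqrt (ip u u)) *\<^sub>R u"
    have "op_norm B e = 1"
      using pos[OF u] by (simp add: nrm e_def scaleR_left scaleR_right real_sqrt_mult real_sqrt_divide)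
    then have "replicate p e \<in> ?U" by auto
    then have "?U \<noteq> {}" by blast
    then show ?thesis
      unfolding form_norm_def
    proof (rule cSUP_least)
      fix hs assume "hs \<in> ?U"
      then show "\<bar>D p (dpow ip (real p + \<nu>) []) x\<^sub>2 hs - D p (dpow ip (real p + \<nu>) []) x\<^sub>1 hs\<bar>
          \<le> C_const p \<nu> * rpow (op_norm B (x\<^sub>2 - x\<^sub>1)) \<nu>"
        unfolding n unfolding x
        by (intro D_dpow_diff_le assms(2,3) u) (auto simp: nrm)
    qed
  qed
  ultimately show ?thesis unfolding f by blast
qed

end
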